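(* Let $\pi/2\le\alpha<\pi$. A function $f$ on $\mathbb{U}$ belongs to the class $\mathcal{MS}(\alpha)$ if and only if there exists a Schwarz function $w$ such that $$f(z)=z\cdot\exp\left[\frac{1}{2i\sin\alpha}\int_{0}^{z}\frac{1}{t}\log\left(\frac{1+e^{i\alpha}w(t)}{1+e^{-i\alpha}w(t)}\right)dt\right]\qquad(z\in\mathbb{U}).$$
   Context: $\mathbb{U}=\{z\in\mathbb{C}:|z|<1\}$. $\mathcal{A}$ is the class of functions $f(z)=z+\sum_{n=2}^\infty a_nz^n$ that are analytic and univalent in $\mathbb{U}$. For $\pi/2\le\alpha<\pi$, $\mathcal{MS}(\alpha)$ is the class of all $f\in\mathcal{A}$ such that $$1+\frac{\alpha-\pi}{2\sin\alpha}<\Re\left(\frac{zf'(z)}{f(z)}\right)<1+\frac{\alpha}{2\sin\alpha}\qquad(z\in\mathbb{U}),$$ where $zf'(z)/f(z)$ is given the value $1$ at $z=0$. A Schwarz function is an analytic function $w$ on $\mathbb{U}$ with $w(0)=0$ and $|w(z)|<1$ for $z\in\mathbb{U}$. The logarithm is the principal branch; the integrand has a removable singularity at $t=0$. *)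

theory Defs
  imports "HOL-Complex_Analysis.Complex_Analysis"
begin

abbreviation unit_disc :: "complex set" ("\<U>")
  where "\<U> \<equiv> ball 0 1"

text \<open>Functions are total on the complex plane here; all the notions below depend only on
  their values on the (open) unit disc.\<close>

definition class_A :: "(complex \<Rightarrow> complex) set" where
  "class_A = {f. f holomorphic_on \<U> \<and> inj_on f \<U> \<and>
     (\<exists>a :: nat \<Rightarrow> complex. \<forall>z\<in>\<U>. (\<lambda>n. a (n + 2) * z ^ (n + 2)) sums (f z - z))}"

definition starlike_quotient :: "(complex \<Rightarrow> complex) \<Rightarrow> complex \<Rightarrow> complex" where
  "starlike_quotient f z = (if z = 0 then 1 else z * deriv f z / f z)"

definition class_MS :: "real \<Rightarrow> (complex \<Rightarrow> complex) set" where
  "class_MS \<alpha> = {f \<in> class_A. \<forall>z\<in>\<U>.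
     1 + (\<alpha> - pi) / (2 * sin \<alpha>) < Re (starlike_quotient f z) \<and>
     Re (starlike_quotient f z) < 1 + \<alpha> / (2 * sin \<alpha>)}"

definition schwarz_function :: "(complex \<Rightarrow> complex) \<Rightarrow> bool" where
  "schwarz_function w \<longleftrightarrow> w holomorphic_on \<U> \<and> w 0 = 0 \<and> (\<forall>z\<in>\<U>. cmod (w z) < 1)"

text \<open>\<open>Ln\<close> is the principal branch; the singularity at \<open>0\<close> is removed by taking the limit.\<close>

definition log_integrand :: "real \<Rightarrow> (complex \<Rightarrow> complex) \<Rightarrow> complex \<Rightarrow> complex" where
  "log_integrand \<alpha> w =
     (let g = (\<lambda>t. 1 / t * Ln ((1 + exp (\<i> * of_real \<alpha>) * w t) / (1 + exp (- \<i> * of_real \<alpha>) * w t)))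
      in (\<lambda>t. if t = 0 then Lim (at 0) g else g t))"

end

theory Submission
  imports Defs
begin

text \<open>Write \<open>f z = z * exp (H z)\<close> with \<open>H 0 = 0\<close>; this is possible for every normalized univalent
  function, because \<open>f z / z\<close> has no zero in the disc. Then \<open>z f' z / f z = 1 + z H' z\<close>, and the
  inequalities that define the class say that \<open>p z = 2 \<i> sin \<alpha> * z H' z\<close> takes its values in the
  horizontal strip \<open>\<alpha> - pi < Im < \<alpha>\<close>.

  This strip is the conformal image of the disc under \<open>u \<mapsto> Ln ((1 + e\<^bsup>i\<alpha>\<^esup> u) / (1 + e\<^bsup>-i\<alpha>\<^esup> u))\<close>,
  which fixes \<open>0\<close>: the Moebius map takes the disc onto the half-plane to the right of the line
  through \<open>0\<close> and \<open>e\<^bsup>i\<alpha>\<^esup>\<close>, seen in that direction, and the principal branch turns this half-plane into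
  the strip. Hence the maps \<open>p\<close> into the strip with \<open>p 0 = 0\<close> are exactly the maps
  \<open>Ln ((1 + e\<^bsup>i\<alpha>\<^esup> w) / (1 + e\<^bsup>-i\<alpha>\<^esup> w))\<close> with \<open>w\<close> a Schwarz function (\<open>schwarz_function_from_strip\<close> and
  \<open>strip_from_schwarz_function\<close>). The integrand of the representation formula is then
  \<open>p t / t = 2 \<i> sin \<alpha> * H' t\<close>, so the formula is \<open>f z = z * exp (H z)\<close> again
  (\<open>contour_integral_log_integrand\<close>).

  What remains is that a function given by the formula is univalent. For
  \<open>pi / 2 \<le> \<alpha> < pi\<close> the lower bound \<open>1 + (\<alpha> - pi) / (2 sin \<alpha>)\<close> is nonnegative
  (\<open>strip_lower_bound_nonneg\<close>), so that \<open>Re (z f' z / f z) > 0\<close> and \<open>f\<close> is starlike.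
  In the coordinate \<open>z = e\<^sup>s\<close>, the function \<open>Ln f\<close> becomes \<open>s + H (e\<^sup>s)\<close> on the left
  half-plane. Its derivative is \<open>z f' z / f z\<close>, and a function on a convex domain whose derivative has
  positive real part is injective (\<open>starlike_imp_inj_on\<close>).\<close>

section \<open>Univalence of starlike functions\<close>

text \<open>The Noshiro-Warschawski criterion. On the segment from \<open>a\<close> to \<open>b\<close>, the inner product of \<open>g\<close>
  with \<open>b - a\<close> has derivative \<open>\<bar>b - a\<bar>\<^sup>2 Re g'\<close>, hence it strictly increases and
  \<open>g a \<noteq> g b\<close>.\<close>

lemma inj_on_if_Re_deriv_pos:
  assumes "convex S"
    and der: "\<And>z. z \<in> S \<Longrightarrow> (g has_field_derivative g' z) (at z)"
    and pos: "\<And>z. z \<in> S \<Longrightarrow> 0 < Re (g' z)"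
  shows "inj_on g S"
proof (rule inj_onI, rule ccontr)
  fix a b assume a: "a \<in> S" and b: "b \<in> S" and eq: "g a = g b" and ne: "a \<noteq> b"
  define d where "d = b - a"
  define \<phi> where "\<phi> t = Re (cnj d * g (a + of_real t * d))" for t :: real
  have "\<phi> 0 < \<phi> 1"
  proof (rule DERIV_pos_imp_increasing[of 0 1 \<phi>])
    fix t :: real assume t: "0 \<le> t" "t \<le> 1"
    define p where "p = a + of_real t * d"
    have "p = (1 - t) *\<^sub>R a + t *\<^sub>R b"
      by (simp add: p_def d_def scaleR_conv_of_real algebra_simps)
    then have p: "p \<in> S"
      using \<open>convex S\<close> a b t by (auto simp: convex_alt)
    have line: "((\<lambda>t. a + of_real t * d) has_vector_derivative d) (at t)"
      by (auto intro!: derivative_eq_intros)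
    have "(g \<circ> (\<lambda>t. a + of_real t * d) has_vector_derivative d * g' p) (at t)"
      using field_vector_diff_chain_at[OF line, of g "g' p"] der[OF p] by (simp add: p_def)
    then have "((\<lambda>t. cnj d * g (a + of_real t * d)) has_vector_derivative cnj d * (d * g' p)) (at t)"
      using has_vector_derivative_mult_right[of _ "d * g' p" "at t" "cnj d"] by (simp add: o_def)
    then have "(\<phi> has_field_derivative Re (cnj d * (d * g' p))) (at t)"
      unfolding \<phi>_def has_real_derivative_iff_has_vector_derivative
      by (rule bounded_linear.has_vector_derivative[OF bounded_linear_Re])
    moreover have "cnj d * (d * g' p) = of_real ((cmod d)\<^sup>2) * g' p"
      by (metis complex_norm_square mult.assoc mult.commute)
    then have "Re (cnj d * (d * g' p)) = (cmod d)\<^sup>2 * Re (g' p)"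
      by (simp only: times_complex.sel Re_complex_of_real Im_complex_of_real mult_zero_left diff_zero)
    then have "0 < Re (cnj d * (d * g' p))"
      using pos[OF p] ne by (simp add: d_def)
    ultimately show "\<exists>y. DERIV \<phi> t :> y \<and> 0 < y" by blast
  qed simp
  then show False by (simp add: \<phi>_def d_def eq)
qed

text \<open>If \<open>f z = z * exp (H z)\<close>, then \<open>G s = s + H (exp s)\<close> is a logarithm of \<open>f (exp s)\<close>, and
  \<open>G' s = z f' z / f z\<close> at \<open>z = exp s\<close>. So \<open>G\<close> is injective on the left half-plane. Since
  \<open>G (s + 2 \<pi> \<i> n) = G s + 2 \<pi> \<i> n\<close>, injectivity survives the passage back from \<open>s\<close> to \<open>z\<close>.\<close>

lemma starlike_imp_inj_on:
  assumes der: "\<And>z. z \<in> \<U> \<Longrightarrow> (H has_field_derivative H' z) (at z)"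
    and pos: "\<And>z. z \<in> \<U> \<Longrightarrow> 0 < Re (1 + z * H' z)"
  shows "inj_on (\<lambda>z. z * exp (H z)) \<U>"
proof -
  define S where "S = {s. Re s < 0}"
  define G where "G s = s + H (exp s)" for s
  have expU: "exp s \<in> \<U>" if "s \<in> S" for s
    using that by (simp add: S_def)
  have injG: "inj_on G S"
  proof (rule inj_on_if_Re_deriv_pos[where g' = "\<lambda>s. 1 + exp s * H' (exp s)"])
    show "convex S" unfolding S_def by (rule convex_halfspace_Re_lt)
  next
    fix s assume s: "s \<in> S"
    show "(G has_field_derivative 1 + exp s * H' (exp s)) (at s)"
      unfolding G_def using DERIV_chain2[OF der[OF expU[OF s]] DERIV_exp]
      by (auto intro!: derivative_eq_intros)
    show "0 < Re (1 + exp s * H' (exp s))" by (rule pos[OF expU[OF s]])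
  qed
  show ?thesis
  proof (rule inj_onI)
    fix z z' assume z: "z \<in> \<U>" and z': "z' \<in> \<U>" and eq: "z * exp (H z) = z' * exp (H z')"
    show "z = z'"
    proof (cases "z = 0 \<or> z' = 0")
      case True
      with eq show ?thesis by auto
    next
      case False
      define s s' where "s = Ln z" and "s' = Ln z'"
      have s: "exp s = z" "s \<in> S" and s': "exp s' = z'" "s' \<in> S"
        using z z' False by (auto simp: s_def s'_def S_def)
      have "exp (G s) = exp (G s')"
        using eq s s' by (simp add: G_def exp_add)
      then obtain n :: int where n: "G s = G s' + (of_int (2 * n) * pi) * \<i>"
        by (auto simp: exp_eq)
      \<comment> \<open>Absorb the ambiguity of the logarithm into the preimage.\<close>
      define s'' where "s'' = s' + (of_int (2 * n) * pi) * \<i>"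
      have exps'': "exp s'' = exp s'" unfolding exp_eq s''_def by blast
      have "s'' \<in> S" using s'(2) by (simp add: S_def s''_def)
      moreover have "G s = G s''" using n exps'' by (simp add: G_def s''_def)
      ultimately have "s = s''" using injG s(2) by (auto dest: inj_onD)
      then show ?thesis using exps'' s s' by simp
    qed
  qed
qed

section \<open>The conformal map of the disc onto the strip\<close>

definition halfplane_map :: "real \<Rightarrow> complex \<Rightarrow> complex" where
  "halfplane_map \<alpha> u = (1 + cis \<alpha> * u) / (1 + cis (- \<alpha>) * u)"

lemma one_plus_cis_mult_neq_0:
  assumes "cmod u < 1"
  shows "1 + cis a * u \<noteq> 0"
proof
  assume "1 + cis a * u = 0"
  then have "cis a * u = -1" by (simp add: add_eq_0_iff)
  then have "cmod (cis a * u) = 1" by simp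
  with assms show False by (simp add: norm_mult)
qed

lemma halfplane_map_neq_0: "cmod u < 1 \<Longrightarrow> halfplane_map \<alpha> u \<noteq> 0"
  by (simp add: halfplane_map_def one_plus_cis_mult_neq_0)

text \<open>Rotated by \<open>- \<alpha>\<close>, the half-plane becomes the lower half-plane. After multiplication of
  numerator and denominator by \<open>cis \<alpha>\<close>, the rotated map is \<open>(1 + cis \<alpha> * u) / (cis \<alpha> + u)\<close>, whose
  imaginary part has the sign of \<open>- sin \<alpha> * (1 - \<bar>u\<bar>\<^sup>2)\<close>.\<close>

lemma Im_halfplane_map_less_0:
  assumes u: "cmod u < 1" and "0 < sin \<alpha>"
  shows "Im (halfplane_map \<alpha> u * cis (- \<alpha>)) < 0"
proof -
  define D where "D = cis \<alpha> + u"
  have D: "D = cis \<alpha> * (1 + cis (- \<alpha>) * u)"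
    by (simp add: D_def distrib_left mult.assoc[symmetric] cis_mult)
  then have "D \<noteq> 0" using one_plus_cis_mult_neq_0[OF u] by simp
  have "halfplane_map \<alpha> u * cis (- \<alpha>) = (1 + cis \<alpha> * u) / D"
    using one_plus_cis_mult_neq_0[OF u, of "- \<alpha>"]
    by (simp add: D halfplane_map_def cis_inverse[symmetric] field_simps)
  also have "\<dots> = (1 + cis \<alpha> * u) * cnj D / of_real ((cmod D)\<^sup>2)"
    using \<open>D \<noteq> 0\<close> by (subst complex_div_cnj) simp
  finally have "Im (halfplane_map \<alpha> u * cis (- \<alpha>)) = Im ((1 + cis \<alpha> * u) * cnj D) / (cmod D)\<^sup>2"
    by (simp only: Im_divide_of_real)
  moreover have "Im ((1 + cis \<alpha> * u) * cnj D) = - (sin \<alpha> * (1 - (cmod u)\<^sup>2))"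
  proof -
    have *: "sin \<alpha> * (sin \<alpha> * Im u) + cos \<alpha> * (cos \<alpha> * Im u) = Im u"
      using sin_cos_squared_add[of \<alpha>] by algebra
    show ?thesis
      unfolding cmod_power2 using * by (simp add: D_def algebra_simps power2_eq_square)
  qed
  moreover have "0 < sin \<alpha> * (1 - (cmod u)\<^sup>2)"
    using assms by (simp add: abs_square_less_1)
  ultimately show ?thesis using \<open>D \<noteq> 0\<close> by (simp add: divide_neg_pos)
qed

text \<open>Passage between half-plane and strip. The sign on the left is that of \<open>sin (Im p - \<alpha>)\<close>;
  the range assumed for \<open>Im p\<close>, which is that of the principal logarithm, leaves just one
  half-period in which this sine is negative.\<close>

lemma Im_exp_cis_less_0_iff:
  assumes "0 \<le> \<alpha>" "\<alpha> < pi" and p: "- pi < Im p" "Im p \<le> pi"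
  shows "Im (exp p * cis (- \<alpha>)) < 0 \<longleftrightarrow> \<alpha> - pi < Im p \<and> Im p < \<alpha>"
proof -
  have "Im (exp p * cis (- \<alpha>)) = exp (Re p) * sin (Im p - \<alpha>)"
    by (simp add: Im_exp Re_exp sin_diff algebra_simps)
  then have "Im (exp p * cis (- \<alpha>)) < 0 \<longleftrightarrow> sin (Im p - \<alpha>) < 0"
    by (simp add: mult_less_0_iff)
  also have "\<dots> \<longleftrightarrow> \<alpha> - pi < Im p \<and> Im p < \<alpha>"
  proof
    assume neg: "sin (Im p - \<alpha>) < 0"
    have "\<not> \<alpha> \<le> Im p"
      using neg assms sin_ge_zero[of "Im p - \<alpha>"] by auto
    moreover have "\<not> Im p \<le> \<alpha> - pi"
      using neg assms sin_ge_zero[of "Im p - \<alpha> + 2 * pi"] by auto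
    ultimately show "\<alpha> - pi < Im p \<and> Im p < \<alpha>" by auto
  next
    assume "\<alpha> - pi < Im p \<and> Im p < \<alpha>"
    then show "sin (Im p - \<alpha>) < 0"
      using sin_gt_zero[of "\<alpha> - Im p"] sin_minus[of "Im p - \<alpha>"] by auto
  qed
  finally show ?thesis .
qed

lemma Im_Ln_halfplane_map:
  assumes "0 < \<alpha>" "\<alpha> < pi" "cmod u < 1"
  shows "\<alpha> - pi < Im (Ln (halfplane_map \<alpha> u))" "Im (Ln (halfplane_map \<alpha> u)) < \<alpha>"
proof -
  have nz: "halfplane_map \<alpha> u \<noteq> 0" by (rule halfplane_map_neq_0[OF assms(3)])
  have "Im (exp (Ln (halfplane_map \<alpha> u)) * cis (- \<alpha>)) < 0"
    using Im_halfplane_map_less_0[OF assms(3)] assms nz by (simp add: sin_gt_zero)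
  then show "\<alpha> - pi < Im (Ln (halfplane_map \<alpha> u))" "Im (Ln (halfplane_map \<alpha> u)) < \<alpha>"
    using Im_exp_cis_less_0_iff[of \<alpha> "Ln (halfplane_map \<alpha> u)"] assms nz mpi_less_Im_Ln Im_Ln_le_pi
    by auto
qed

definition halfplane_inv :: "real \<Rightarrow> complex \<Rightarrow> complex" where
  "halfplane_inv \<alpha> E = (E - 1) / (cis \<alpha> - cis (- \<alpha>) * E)"

text \<open>The squares of the two sides differ by \<open>- 4 * sin \<alpha> * Im (E * cis (- \<alpha>))\<close>. The inequality shows
  both that \<open>halfplane_inv\<close> has no pole on the half-plane and that its values lie in the disc.\<close>

lemma halfplane_inv_numerator_less_denominator:
  assumes "0 < sin \<alpha>" and "Im (E * cis (- \<alpha>)) < 0"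
  shows "cmod (E - 1) < cmod (cis \<alpha> - cis (- \<alpha>) * E)"
proof -
  define x y where "x = Re E" and "y = Im E"
  have E: "E = Complex x y" by (simp add: x_def y_def)
  have *: "(c - (c * x + s * y))\<^sup>2 + (s - (c * y - s * x))\<^sup>2 - ((x - 1)\<^sup>2 + y\<^sup>2) =
      - (4 * s * (y * c - x * s))" if "s\<^sup>2 + c\<^sup>2 = 1" for s c
    using that by algebra
  have "(cmod (cis \<alpha> - cis (- \<alpha>) * E))\<^sup>2 - (cmod (E - 1))\<^sup>2 =
      - (4 * sin \<alpha> * Im (E * cis (- \<alpha>)))"
    using *[of "sin \<alpha>" "cos \<alpha>"] by (simp add: E cmod_power2)
  also have "\<dots> > 0"
    using assms by (simp add: mult_pos_neg)
  finally show ?thesis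
    by (simp add: power2_less_imp_less)
qed

lemma norm_halfplane_inv_less_1:
  assumes "0 < sin \<alpha>" and "Im (E * cis (- \<alpha>)) < 0"
  shows "cmod (halfplane_inv \<alpha> E) < 1"
  using halfplane_inv_numerator_less_denominator[OF assms] norm_ge_zero[of "E - 1"]
  by (auto simp: halfplane_inv_def norm_divide divide_simps)

lemma halfplane_map_inv:
  assumes "0 < sin \<alpha>" and "Im (E * cis (- \<alpha>)) < 0"
  shows "halfplane_map \<alpha> (halfplane_inv \<alpha> E) = E"
proof -
  define D where "D = cis \<alpha> - cis (- \<alpha>) * E"
  have D: "D \<noteq> 0"
    using halfplane_inv_numerator_less_denominator[OF assms] by (auto simp: D_def)
  have nz: "cis \<alpha> - cis (- \<alpha>) \<noteq> 0"
    using assms by (simp add: complex_eq_iff)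
  have "1 + cis \<alpha> * halfplane_inv \<alpha> E = E * (cis \<alpha> - cis (- \<alpha>)) / D"
    "1 + cis (- \<alpha>) * halfplane_inv \<alpha> E = (cis \<alpha> - cis (- \<alpha>)) / D"
    using D by (simp_all add: halfplane_inv_def D_def[symmetric] add_divide_eq_iff)
      (simp_all add: D_def algebra_simps)
  then show ?thesis using D nz by (simp add: halfplane_map_def)
qed

section \<open>The integral in the exponent\<close>

text \<open>The limit that fills the removable singularity is a difference quotient at \<open>0\<close>.\<close>

lemma log_integrand_eq:
  assumes p: "p holomorphic_on \<U>" "p 0 = 0"
    and Ln: "\<And>t. t \<in> \<U> \<Longrightarrow> Ln (halfplane_map \<alpha> (w t)) = p t"
    and t: "t \<in> \<U>"
  shows "log_integrand \<alpha> w t = (if t = 0 then deriv p 0 else p t / t)"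
proof -
  define g where "g t = 1 / t * Ln ((1 + exp (\<i> * of_real \<alpha>) * w t) / (1 + exp (- \<i> * of_real \<alpha>) * w t))" for t
  have g: "g t = p t / t" if "t \<in> \<U>" for t
    using Ln[OF that] by (simp add: g_def halfplane_map_def cis_conv_exp)
  have "(p has_field_derivative deriv p 0) (at 0)"
    using p by (intro holomorphic_derivI) auto
  then have "(\<lambda>t. p t / t) \<midarrow>0\<rightarrow> deriv p 0"
    using p(2) by (simp add: has_field_derivative_iff)
  moreover have "\<forall>\<^sub>F t in at 0. p t / t = g t"
    using eventually_at_in_open'[of "\<U>" 0] by (auto elim!: eventually_mono simp: g)
  ultimately have "g \<midarrow>0\<rightarrow> deriv p 0"
    by (rule Lim_transform_eventually)
  then have "Lim (at 0) g = deriv p 0"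
    by (intro tendsto_Lim) auto
  moreover have "log_integrand \<alpha> w = (\<lambda>t. if t = 0 then Lim (at 0) g else g t)"
    by (simp only: log_integrand_def Let_def g_def[abs_def])
  ultimately show ?thesis
    by (simp add: g[OF t])
qed

text \<open>If the logarithm is \<open>c * (t * H' t)\<close>, the division by \<open>t\<close> in the integrand leaves
  \<open>c * H' t\<close>, at \<open>t = 0\<close> too, and \<open>c * H\<close> is a primitive.\<close>

lemma contour_integral_log_integrand:
  assumes H: "\<And>z. z \<in> \<U> \<Longrightarrow> (H has_field_derivative H' z) (at z)"
    and H': "H' holomorphic_on \<U>"
    and Ln: "\<And>t. t \<in> \<U> \<Longrightarrow> Ln (halfplane_map \<alpha> (w t)) = c * (t * H' t)"
    and z: "z \<in> \<U>"
  shows "contour_integral (linepath 0 z) (log_integrand \<alpha> w) = c * (H z - H 0)"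
proof -
  define p where "p t = c * (t * H' t)" for t
  have p: "p holomorphic_on \<U>" unfolding p_def by (intro holomorphic_intros H')
  have "(H' has_field_derivative deriv H' 0) (at 0)"
    using H' by (intro holomorphic_derivI) auto
  then have "(p has_field_derivative c * H' 0) (at 0)"
    unfolding p_def by (auto intro!: derivative_eq_intros)
  then have p0: "deriv p 0 = c * H' 0" by (rule DERIV_imp_deriv)
  have integrand: "log_integrand \<alpha> w t = c * H' t" if "t \<in> \<U>" for t
    using log_integrand_eq[OF p _ _ that, of \<alpha> w] Ln p0 by (auto simp: p_def)
  have seg: "path_image (linepath 0 z) \<subseteq> \<U>"
    using z by (simp add: closed_segment_subset)
  have "((\<lambda>t. c * H t) has_field_derivative c * H' t) (at t within \<U>)" if "t \<in> \<U>" for t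
    by (intro DERIV_cmult has_field_derivative_at_within[OF H] that)
  from contour_integral_primitive[OF this _ seg]
  have "((\<lambda>t. c * H' t) has_contour_integral c * H z - c * H 0) (linepath 0 z)"
    by simp
  then have "(log_integrand \<alpha> w has_contour_integral c * H z - c * H 0) (linepath 0 z)"
    by (rule has_contour_integral_eq) (use seg integrand in auto)
  then show ?thesis
    by (simp add: contour_integral_unique right_diff_distrib)
qed

section \<open>The class in terms of the logarithm of f z / z\<close>

lemma class_A_normalized:
  assumes "f \<in> class_A"
  shows "f 0 = 0" "deriv f 0 = 1"
proof -
  obtain a where a: "\<And>z. z \<in> \<U> \<Longrightarrow> (\<lambda>n. a (n + 2) * z ^ (n + 2)) sums (f z - z)"
    and hol: "f holomorphic_on \<U>"
    using assms unfolding class_A_def by blast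
  show f0: "f 0 = 0" using a[of 0] sums_unique2[OF sums_zero] by force
  \<comment> \<open>The coefficients of \<open>f z - z\<close> as a power series that starts at degree \<open>0\<close>.\<close>
  define c where "c n = (if n < 2 then 0 else a n)" for n
  have c: "(\<lambda>n. c n * z ^ n) sums (f z - z)" if "z \<in> \<U>" for z
    using a[OF that] sums_iff_shift[of "\<lambda>n. c n * z ^ n" 2 "f z - z"]
    by (simp add: c_def lessThan_Suc numeral_2_eq_2)
  have "((\<lambda>z. \<Sum>n. c n * z ^ n) has_field_derivative (\<Sum>n. diffs c n * 0 ^ n)) (at 0)"
    using termdiffs_strong[of c "1/2" 0] c[of "1/2"] by (auto simp: sums_iff)
  then have "((\<lambda>z. \<Sum>n. c n * z ^ n) has_field_derivative 0) (at 0)"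
    by (simp add: diffs_def c_def)
  then have "((\<lambda>z. f z - z) has_field_derivative 0) (at 0)"
    by (rule has_field_derivative_transform_within_open[where S = \<U>]) (use c in \<open>auto simp: sums_iff\<close>)
  then have "((\<lambda>z. (f z - z) + z) has_field_derivative 0 + 1) (at 0)"
    by (intro DERIV_add DERIV_ident)
  then show "deriv f 0 = 1" by (simp add: DERIV_imp_deriv)
qed

lemma class_A_I:
  assumes hol: "f holomorphic_on \<U>" and "inj_on f \<U>" and f0: "f 0 = 0" and f1: "deriv f 0 = 1"
  shows "f \<in> class_A"
proof -
  define a where "a n = (deriv ^^ n) f 0 / fact n" for n
  have "(\<lambda>n. a (n + 2) * z ^ (n + 2)) sums (f z - z)" if "z \<in> \<U>" for z
  proof -
    have "(\<lambda>n. a n * z ^ n) sums f z"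
      using holomorphic_power_series[OF hol that] by (simp add: a_def)
    moreover have "(\<Sum>i<2. a i * z ^ i) = z"
      by (simp add: a_def f0 f1 lessThan_Suc numeral_2_eq_2)
    ultimately show ?thesis
      unfolding sums_iff_shift[of "\<lambda>n. a n * z ^ n" 2] by simp
  qed
  then show ?thesis using hol \<open>inj_on f \<U>\<close> unfolding class_A_def by blast
qed

text \<open>The only zero of the injective function \<open>f\<close> is the simple one at \<open>0\<close>, so \<open>f z / z\<close> extends to a
  function without zeros on the disc, which has a holomorphic logarithm.\<close>

lemma class_A_exp_form:
  assumes "f \<in> class_A"
  obtains H where "H holomorphic_on \<U>" "H 0 = 0" "\<And>z. z \<in> \<U> \<Longrightarrow> f z = z * exp (H z)"
proof -
  note f01 = class_A_normalized[OF assms]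
  have hol: "f holomorphic_on \<U>" and inj: "inj_on f \<U>"
    using assms by (auto simp: class_A_def)
  define h where "h z = (if z = 0 then deriv f 0 else (f z - f 0) / (z - 0))" for z
  have h: "h holomorphic_on \<U>" unfolding h_def by (rule pole_lemma) (use hol in auto)
  have nz: "h z \<noteq> 0" if "z \<in> \<U>" for z
    using inj_onD[OF inj, of z 0] that f01 by (auto simp: h_def)
  obtain H0 where H0: "H0 holomorphic_on \<U>" "\<And>z. z \<in> \<U> \<Longrightarrow> exp (H0 z) = h z"
    using holomorphic_logarithm_exists[of \<U> h 0] h nz by auto
  show thesis
  proof
    show "(\<lambda>z. H0 z - H0 0) holomorphic_on \<U>" by (intro holomorphic_intros H0)
    show "f z = z * exp (H0 z - H0 0)" if "z \<in> \<U>" for z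
      using H0(2)[OF that] H0(2)[of 0] f01 by (auto simp: exp_diff h_def)
  qed simp
qed

lemma deriv_exp_form:
  assumes der: "\<And>z. z \<in> \<U> \<Longrightarrow> (H has_field_derivative H' z) (at z)"
    and f: "\<And>z. z \<in> \<U> \<Longrightarrow> f z = z * exp (H z)"
    and z: "z \<in> \<U>"
  shows "(f has_field_derivative exp (H z) * (1 + z * H' z)) (at z)"
proof -
  have "((\<lambda>z. z * exp (H z)) has_field_derivative exp (H z) * (1 + z * H' z)) (at z)"
    using der[OF z] by (auto intro!: derivative_eq_intros simp: algebra_simps)
  then show ?thesis
    by (rule has_field_derivative_transform_within_open[where S = \<U>]) (use z f in auto)
qed

lemma starlike_quotient_exp_form:
  assumes der: "\<And>z. z \<in> \<U> \<Longrightarrow> (H has_field_derivative H' z) (at z)"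
    and f: "\<And>z. z \<in> \<U> \<Longrightarrow> f z = z * exp (H z)"
    and z: "z \<in> \<U>"
  shows "starlike_quotient f z = 1 + z * H' z"
  using DERIV_imp_deriv[OF deriv_exp_form[OF der f z]] f[OF z]
  by (simp add: starlike_quotient_def)

text \<open>By \<open>sin x \<ge> x - x\<^sup>3 / 6\<close> it is enough that \<open>x\<^sup>2 \<le> 3\<close>, which holds as
  \<open>pi / 2 < 1.6\<close>.\<close>

lemma le_two_sin:
  assumes "0 \<le> x" "x \<le> pi / 2"
  shows "x \<le> 2 * sin x"
proof -
  have "\<bar>sin x - x\<bar> \<le> \<bar>x\<bar> ^ 3 / 6"
    using Maclaurin_sin_bound[of x 3] by (simp add: eval_nat_numeral sin_coeff_def)
  moreover have "x\<^sup>2 \<le> 1.6\<^sup>2"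
    using assms pi_approx by (intro power_mono) auto
  then have "x * x\<^sup>2 \<le> x * 3"
    using assms by (intro mult_left_mono) (auto simp: power2_eq_square)
  then have "\<bar>x\<bar> ^ 3 / 6 \<le> x / 2"
    using assms by (simp add: power2_eq_square power3_eq_cube)
  ultimately show ?thesis by linarith
qed

text \<open>This is where \<open>pi / 2 \<le> \<alpha>\<close> enters: it makes every function given by the representation
  formula starlike. With \<open>x = pi - \<alpha>\<close> the claim is \<open>x \<le> 2 * sin x\<close>.\<close>

lemma strip_lower_bound_nonneg:
  assumes "pi / 2 \<le> \<alpha>" "\<alpha> < pi"
  shows "0 \<le> 1 + (\<alpha> - pi) / (2 * sin \<alpha>)"
proof -
  have "pi - \<alpha> \<le> 2 * sin (pi - \<alpha>)" by (rule le_two_sin) (use assms in auto)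
  moreover have "0 < sin \<alpha>" using assms pi_gt_zero by (intro sin_gt_zero) linarith+
  ultimately show ?thesis by (simp add: field_simps)
qed

text \<open>The real part of \<open>z f' z / f z - 1 = z H' z\<close> is confined to a vertical strip; the factor
  \<open>2 \<i> sin \<alpha>\<close> turns it into the horizontal strip in which the logarithm of \<open>halfplane_map\<close>
  takes its values. From right to left, univalence of \<open>f\<close> comes from starlikeness.\<close>

lemma class_MS_iff_exp_form:
  assumes \<alpha>: "pi / 2 \<le> \<alpha>" "\<alpha> < pi"
  shows "f \<in> class_MS \<alpha> \<longleftrightarrow> (\<exists>H. H holomorphic_on \<U> \<and> H 0 = 0 \<and>
    (\<forall>z\<in>\<U>. f z = z * exp (H z) \<and>
       \<alpha> - pi < Im (2 * \<i> * of_real (sin \<alpha>) * (z * deriv H z)) \<and>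
       Im (2 * \<i> * of_real (sin \<alpha>) * (z * deriv H z)) < \<alpha>))"
proof -
  have s: "0 < sin \<alpha>" using \<alpha> pi_gt_zero by (intro sin_gt_zero) linarith+
  have strip: "1 + (\<alpha> - pi) / (2 * sin \<alpha>) < Re (1 + q) \<and> Re (1 + q) < 1 + \<alpha> / (2 * sin \<alpha>) \<longleftrightarrow>
      \<alpha> - pi < Im (2 * \<i> * of_real (sin \<alpha>) * q) \<and> Im (2 * \<i> * of_real (sin \<alpha>) * q) < \<alpha>" for q
  proof -
    have "Im (2 * \<i> * of_real (sin \<alpha>) * q) = Re q * (2 * sin \<alpha>)" by simp
    then show ?thesis
      using s by (simp only: plus_complex.sel one_complex.sel add_less_cancel_left)
        (simp add: pos_divide_less_eq pos_less_divide_eq)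
  qed
  have der: "(H has_field_derivative deriv H z) (at z)" if "H holomorphic_on \<U>" "z \<in> \<U>" for H z
    using that by (intro holomorphic_derivI) auto
  show ?thesis
  proof
    assume f: "f \<in> class_MS \<alpha>"
    then have "f \<in> class_A" by (simp add: class_MS_def)
    then obtain H where H: "H holomorphic_on \<U>" "H 0 = 0" "\<And>z. z \<in> \<U> \<Longrightarrow> f z = z * exp (H z)"
      by (rule class_A_exp_form) blast
    have "starlike_quotient f z = 1 + z * deriv H z" if "z \<in> \<U>" for z
      by (rule starlike_quotient_exp_form[OF der[OF H(1)] H(3) that])
    then have "\<alpha> - pi < Im (2 * \<i> * of_real (sin \<alpha>) * (z * deriv H z)) \<and>
       Im (2 * \<i> * of_real (sin \<alpha>) * (z * deriv H z)) < \<alpha>" if "z \<in> \<U>" for z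
      unfolding strip[symmetric] using f that by (auto simp: class_MS_def)
    with H show "\<exists>H. H holomorphic_on \<U> \<and> H 0 = 0 \<and>
    (\<forall>z\<in>\<U>. f z = z * exp (H z) \<and>
       \<alpha> - pi < Im (2 * \<i> * of_real (sin \<alpha>) * (z * deriv H z)) \<and>
       Im (2 * \<i> * of_real (sin \<alpha>) * (z * deriv H z)) < \<alpha>)" by blast
  next
    assume "\<exists>H. H holomorphic_on \<U> \<and> H 0 = 0 \<and>
    (\<forall>z\<in>\<U>. f z = z * exp (H z) \<and>
       \<alpha> - pi < Im (2 * \<i> * of_real (sin \<alpha>) * (z * deriv H z)) \<and>
       Im (2 * \<i> * of_real (sin \<alpha>) * (z * deriv H z)) < \<alpha>)"
    then obtain H where H: "H holomorphic_on \<U>" "H 0 = 0"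
      and f: "\<And>z. z \<in> \<U> \<Longrightarrow> f z = z * exp (H z)"
      and bounds: "\<And>z. z \<in> \<U> \<Longrightarrow> 1 + (\<alpha> - pi) / (2 * sin \<alpha>) < Re (1 + z * deriv H z) \<and>
        Re (1 + z * deriv H z) < 1 + \<alpha> / (2 * sin \<alpha>)"
      unfolding strip[symmetric] by blast
    note derf = deriv_exp_form[OF der[OF H(1)] f]
    have "f \<in> class_A"
    proof (rule class_A_I)
      show "f holomorphic_on \<U>"
        using derf by (metis holomorphic_on_open open_ball)
      have "inj_on (\<lambda>z. z * exp (H z)) \<U>"
        using starlike_imp_inj_on[OF der[OF H(1)]] bounds strip_lower_bound_nonneg[OF \<alpha>]
        by (meson le_less_trans)
      then show "inj_on f \<U>" using inj_on_cong[of \<U> f "\<lambda>z. z * exp (H z)"] f by blast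
      show "f 0 = 0" using f[of 0] by simp
      show "deriv f 0 = 1" using DERIV_imp_deriv[OF derf[of 0]] H by simp
    qed
    moreover have "starlike_quotient f z = 1 + z * deriv H z" if "z \<in> \<U>" for z
      by (rule starlike_quotient_exp_form[OF der[OF H(1)] f that])
    ultimately show "f \<in> class_MS \<alpha>"
      using bounds by (simp add: class_MS_def)
  qed
qed

section \<open>Schwarz functions and the strip\<close>

text \<open>The Schwarz function is \<open>halfplane_inv \<alpha> (exp (p z))\<close>. The strip lies in
  \<open>- pi < Im < pi\<close>, so the principal logarithm recovers \<open>p\<close> itself from \<open>exp (p z)\<close>.\<close>

lemma schwarz_function_from_strip:
  assumes \<alpha>: "0 < \<alpha>" "\<alpha> < pi" and p: "p holomorphic_on \<U>" "p 0 = 0"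
    and strip: "\<And>z. z \<in> \<U> \<Longrightarrow> \<alpha> - pi < Im (p z) \<and> Im (p z) < \<alpha>"
  obtains w where "schwarz_function w" "\<And>z. z \<in> \<U> \<Longrightarrow> Ln (halfplane_map \<alpha> (w z)) = p z"
proof
  define w where "w z = halfplane_inv \<alpha> (exp (p z))" for z
  have s: "0 < sin \<alpha>" using \<alpha> by (rule sin_gt_zero)
  have halfplane: "Im (exp (p z) * cis (- \<alpha>)) < 0" if "z \<in> \<U>" for z
    using Im_exp_cis_less_0_iff[of \<alpha> "p z"] strip[OF that] \<alpha> by auto
  have "w holomorphic_on \<U>"
    unfolding w_def halfplane_inv_def
    using halfplane_inv_numerator_less_denominator[OF s halfplane]
    by (intro holomorphic_intros p) fastforce
  moreover have "cmod (w z) < 1" if "z \<in> \<U>" for z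
    unfolding w_def by (rule norm_halfplane_inv_less_1[OF s halfplane[OF that]])
  ultimately show "schwarz_function w"
    by (simp add: schwarz_function_def) (simp add: w_def halfplane_inv_def p)
  show "Ln (halfplane_map \<alpha> (w z)) = p z" if "z \<in> \<U>" for z
    using strip[OF that] \<alpha> by (simp add: w_def halfplane_map_inv[OF s halfplane[OF that]])
qed

text \<open>The half-plane avoids the branch cut: on the cut the imaginary part of the logarithm
  would be \<open>pi\<close>, which exceeds \<open>\<alpha>\<close>.\<close>

lemma strip_from_schwarz_function:
  assumes \<alpha>: "0 < \<alpha>" "\<alpha> < pi" and w: "schwarz_function w"
  shows "(\<lambda>z. Ln (halfplane_map \<alpha> (w z))) holomorphic_on \<U>"
    "Ln (halfplane_map \<alpha> (w 0)) = 0"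
    "\<And>z. z \<in> \<U> \<Longrightarrow> \<alpha> - pi < Im (Ln (halfplane_map \<alpha> (w z)))"
    "\<And>z. z \<in> \<U> \<Longrightarrow> Im (Ln (halfplane_map \<alpha> (w z))) < \<alpha>"
proof -
  have w': "w holomorphic_on \<U>" "w 0 = 0" "\<And>z. z \<in> \<U> \<Longrightarrow> cmod (w z) < 1"
    using w by (auto simp: schwarz_function_def)
  show lo: "\<alpha> - pi < Im (Ln (halfplane_map \<alpha> (w z)))"
    and hi: "Im (Ln (halfplane_map \<alpha> (w z))) < \<alpha>" if "z \<in> \<U>" for z
    using Im_Ln_halfplane_map[OF \<alpha> w'(3)[OF that]] by auto
  show "Ln (halfplane_map \<alpha> (w 0)) = 0" by (simp add: w' halfplane_map_def)
  have "halfplane_map \<alpha> (w z) \<notin> \<real>\<^sub>\<le>\<^sub>0" if "z \<in> \<U>" for z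
  proof
    assume "halfplane_map \<alpha> (w z) \<in> \<real>\<^sub>\<le>\<^sub>0"
    then have "Im (Ln (halfplane_map \<alpha> (w z))) = pi"
      using halfplane_map_neq_0[OF w'(3)[OF that], of \<alpha>]
      by (subst Im_Ln_eq_pi) (auto simp: complex_nonpos_Reals_iff complex_eq_iff)
    with hi[OF that] \<alpha> show False by simp
  qed
  moreover have "(\<lambda>z. halfplane_map \<alpha> (w z)) holomorphic_on \<U>"
    unfolding halfplane_map_def
    using one_plus_cis_mult_neq_0[OF w'(3), of _ "- \<alpha>"] by (intro holomorphic_intros w') auto
  ultimately show "(\<lambda>z. Ln (halfplane_map \<alpha> (w z))) holomorphic_on \<U>"
    by (intro holomorphic_on_Ln')
qed

theorem theorem1:
  fixes \<alpha> :: real and f :: "complex \<Rightarrow> complex"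
  assumes "pi / 2 \<le> \<alpha>" and "\<alpha> < pi"
  shows "f \<in> class_MS \<alpha> \<longleftrightarrow>
    (\<exists>w. schwarz_function w \<and>
      (\<forall>z\<in>\<U>. f z = z * exp (1 / (2 * \<i> * of_real (sin \<alpha>)) *
         contour_integral (linepath 0 z) (log_integrand \<alpha> w))))"
    (is "_ \<longleftrightarrow> ?R")
proof -
  have \<alpha>: "0 < \<alpha>" "\<alpha> < pi" using assms pi_gt_zero by linarith+
  have s: "0 < sin \<alpha>" using \<alpha> by (rule sin_gt_zero)
  define c where "c = 2 * \<i> * of_real (sin \<alpha>)"
  have c: "c \<noteq> 0" using s by (simp add: c_def)
  show ?thesis
  proof
    assume "f \<in> class_MS \<alpha>"
    then obtain H where H: "H holomorphic_on \<U>" "H 0 = 0"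
      and f: "\<And>z. z \<in> \<U> \<Longrightarrow> f z = z * exp (H z)"
      and strip: "\<And>z. z \<in> \<U> \<Longrightarrow> \<alpha> - pi < Im (c * (z * deriv H z)) \<and> Im (c * (z * deriv H z)) < \<alpha>"
      unfolding class_MS_iff_exp_form[OF assms] c_def by blast
    have H': "deriv H holomorphic_on \<U>" using H by (intro holomorphic_deriv) auto
    obtain w where w: "schwarz_function w"
      and Ln: "\<And>z. z \<in> \<U> \<Longrightarrow> Ln (halfplane_map \<alpha> (w z)) = c * (z * deriv H z)"
      by (rule schwarz_function_from_strip[OF \<alpha> _ _ strip, of "\<lambda>z. z"])
         (auto intro!: holomorphic_intros H')
    have "contour_integral (linepath 0 z) (log_integrand \<alpha> w) = c * (H z - H 0)" if "z \<in> \<U>" for z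
      using H by (intro contour_integral_log_integrand[OF _ H' Ln that] holomorphic_derivI) auto
    then show ?R using w f c H(2) unfolding c_def[symmetric] by (intro exI[of _ w]) auto
  next
    assume ?R
    then obtain w where w: "schwarz_function w"
      and f: "\<And>z. z \<in> \<U> \<Longrightarrow> f z = z * exp (1 / c * contour_integral (linepath 0 z) (log_integrand \<alpha> w))"
      unfolding c_def by blast
    define p where "p z = Ln (halfplane_map \<alpha> (w z))" for z
    note p = strip_from_schwarz_function[OF \<alpha> w, folded p_def]
    \<comment> \<open>\<open>k\<close> is going to be \<open>H'\<close>: the quotient \<open>p z / (c * z)\<close> with its singularity removed.\<close>
    define k where "k z = (if z = 0 then deriv p 0 else (p z - p 0) / (z - 0)) / c" for z
    have k: "k holomorphic_on \<U>"
      unfolding k_def using pole_lemma[of p \<U> 0] p(1) c by (intro holomorphic_intros) auto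
    have pk: "p z = c * (z * k z)" for z
      using p(2) c by (simp add: k_def)
    obtain H where H: "\<And>z. z \<in> \<U> \<Longrightarrow> (H has_field_derivative k z) (at z within \<U>)"
      using holomorphic_convex_primitive'[of \<U> k] k by auto
    then have H: "(H has_field_derivative k z) (at z)" if "z \<in> \<U>" for z
      using that by (metis at_within_open open_ball)
    have f: "f z = z * exp (H z - H 0)" if "z \<in> \<U>" for z
      using f[OF that] contour_integral_log_integrand[OF H k _ that, of \<alpha> w c] pk c
      by (simp add: p_def)
    have "deriv (\<lambda>z. H z - H 0) z = k z" if "z \<in> \<U>" for z
      using H[OF that] by (intro DERIV_imp_deriv) (auto intro!: derivative_eq_intros)
    moreover have "H holomorphic_on \<U>"
      using H by (metis holomorphic_on_open open_ball)
    then have "(\<lambda>z. H z - H 0) holomorphic_on \<U>"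
      by (intro holomorphic_intros)
    ultimately show "f \<in> class_MS \<alpha>"
      unfolding class_MS_iff_exp_form[OF assms] c_def[symmetric]
      using f p(3,4) by (intro exI[of _ "\<lambda>z. H z - H 0"]) (auto simp flip: pk)
  qed
qed

end
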